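(* Let $A\in\mathbb{R}^{n\times n}$ and $B\in\mathbb{R}^{m\times m}$ be symmetric positive definite, $C_1\in\mathbb{R}^{n\times s}$, $C_2\in\mathbb{R}^{m\times s}$, and let $N\ge 1$. Suppose that block Krylov bases $\mathcal{V}_j,\mathcal{W}_j$ ($1\le j\le N+1$) and block matrices $\mathcal{H}_{j+1,j},\mathcal{G}_{j+1,j}$ ($1\le j\le N$) as described in the context are given, and that the matrix-oriented CG iteration with $X_0=O_{n,m}$ can be carried out for $k=0,\ldots,N-1$ without division by zero. Then the factorized CG iteration can also be carried out for $k=0,\ldots,N-1$ without division by zero, it produces the same scalars $\alpha_k,\beta_k$ ($0\le k\le N-1$) and $\rho_k$ ($0\le k\le N$) as the matrix-oriented CG iteration, and $$X_k=\mathcal{V}_k\mathbf{X}_k\mathcal{W}_k^\top,\quad R_k=\mathcal{V}_{k+1}\mathbf{R}_k\mathcal{W}_{k+1}^\top,\quad P_k=\mathcal{V}_{k+1}\mathbf{P}_k\mathcal{W}_{k+1}^\top\qquad(0\le k\le N),$$ $$Q_k=\mathcal{V}_{k+2}\mathbf{Q}_k\mathcal{W}_{k+2}^\top\qquad(0\le k\le N-1),$$ where for $k=0$ the first identity is read as $X_0=O_{n,m}$. Moreover $\|R_k\|=\|\mathbf{R}_k\|$ for $0\le k\le N$, so the two methods have the same relative residual norms.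
   Context: $\langle X,Y\rangle:=\mathrm{tr}(X^\top Y)$, $\|\cdot\|$ is the Frobenius norm, $O_{p,q}$ is the $p\times q$ zero matrix, and $M(1:i,1:j)$ is the upper-left $i\times j$ submatrix of $M$. The equation to be solved is the Sylvester equation $AX+XB=C_1C_2^\top$ for $X\in\mathbb{R}^{n\times m}$. Matrix-oriented CG (with $X_0=O_{n,m}$): $R_0=C_1C_2^\top$, $P_0=R_0$, $\rho_0=\langle R_0,R_0\rangle$, and for $k=0,1,2,\ldots$: $Q_k=AP_k+P_kB$; $\alpha_k=\rho_k/\langle P_k,Q_k\rangle$; $X_{k+1}=X_k+\alpha_kP_k$; $R_{k+1}=R_k-\alpha_kQ_k$; $\rho_{k+1}=\langle R_{k+1},R_{k+1}\rangle$; $\beta_k=\rho_{k+1}/\rho_k$; $P_{k+1}=R_{k+1}+\beta_kP_k$. Block Krylov bases (as produced by the block Lanczos process): $C_1=V_1R_{\mathrm L}$ and $C_2=W_1R_{\mathrm R}$ are QR factorizations with $V_1\in\mathbb{R}^{n\times s}$, $W_1\in\mathbb{R}^{m\times s}$ column-orthonormal and $R_{\mathrm L},R_{\mathrm R}\in\mathbb{R}^{s\times s}$; $\mathcal{V}_j=[V_1,\ldots,V_j]\in\mathbb{R}^{n\times js}$ and $\mathcal{W}_j=[W_1,\ldots,W_j]\in\mathbb{R}^{m\times js}$ have orthonormal columns; and $\mathcal{H}_{j+1,j},\mathcal{G}_{j+1,j}\in\mathbb{R}^{(j+1)s\times js}$ are block Hessenberg matrices satisfying $A\mathcal{V}_j=\mathcal{V}_{j+1}\mathcal{H}_{j+1,j}$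 and $B^\top\mathcal{W}_j=\mathcal{W}_{j+1}\mathcal{G}_{j+1,j}$. Factorized CG: $\mathbf{X}_0$ is the empty matrix, $\mathbf{R}_0=R_{\mathrm L}R_{\mathrm R}^\top$, $\mathbf{P}_0=\mathbf{R}_0$, $\rho_0=\langle\mathbf{R}_0,\mathbf{R}_0\rangle$, and for $k=0,1,2,\ldots$: $\mathbf{Q}_k=[\mathcal{H}_{k+2,k+1}\mathbf{P}_k,\ O_{(k+2)s,s}]+\begin{bmatrix}\mathbf{P}_k\mathcal{G}_{k+2,k+1}^\top\\ O_{s,(k+2)s}\end{bmatrix}$; $\alpha_k=\rho_k/\langle\mathbf{P}_k,\mathbf{Q}_k(1:(k+1)s,1:(k+1)s)\rangle$; $\mathbf{X}_{k+1}=\begin{bmatrix}\mathbf{X}_k&O_{ks,s}\\O_{s,ks}&O_{s,s}\end{bmatrix}+\alpha_k\mathbf{P}_k$; $\mathbf{R}_{k+1}=\begin{bmatrix}\mathbf{R}_k&O_{(k+1)s,s}\\O_{s,(k+1)s}&O_{s,s}\end{bmatrix}-\alpha_k\mathbf{Q}_k$; $\rho_{k+1}=\langle\mathbf{R}_{k+1},\mathbf{R}_{k+1}\rangle$; $\beta_k=\rho_{k+1}/\rho_k$; $\mathbf{P}_{k+1}=\mathbf{R}_{k+1}+\begin{bmatrix}\beta_k\mathbf{P}_k&O_{(k+1)s,s}\\O_{s,(k+1)s}&O_{s,s}\end{bmatrix}$. Here $\mathbf{X}_k\in\mathbb{R}^{ks\times ks}$, $\mathbf{R}_k,\mathbf{P}_k\in\mathbb{R}^{(k+1)s\times(k+1)s}$,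 $\mathbf{Q}_k\in\mathbb{R}^{(k+2)s\times(k+2)s}$. All computations are in exact arithmetic. *)

theory Defs
  imports Complex_Main "Jordan_Normal_Form.Matrix" "Jordan_Normal_Form.DL_Submatrix"
begin

definition mat_trace :: "real mat \<Rightarrow> real" where
  "mat_trace M = (\<Sum>i<dim_row M. M $$ (i, i))"

definition frob_inner :: "real mat \<Rightarrow> real mat \<Rightarrow> real" where
  "frob_inner X Y = mat_trace (transpose_mat X * Y)"

definition frob_norm :: "real mat \<Rightarrow> real" where
  "frob_norm X = sqrt (frob_inner X X)"

definition sym_pos_def :: "nat \<Rightarrow> real mat \<Rightarrow> bool" where
  "sym_pos_def n A \<longleftrightarrow> A \<in> carrier_mat n n \<and> transpose_mat A = A \<and>
     (\<forall>x \<in> carrier_vec n. x \<noteq> 0\<^sub>v n \<longrightarrow> 0 < x \<bullet> (A *\<^sub>v x))"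

definition col_orthonormal :: "real mat \<Rightarrow> bool" where
  "col_orthonormal M \<longleftrightarrow> transpose_mat M * M = 1\<^sub>m (dim_col M)"

definition append_cols :: "real mat \<Rightarrow> real mat \<Rightarrow> real mat" where
  "append_cols M M' = four_block_mat M M' (0\<^sub>m 0 (dim_col M)) (0\<^sub>m 0 (dim_col M'))"

text \<open>The family V is indexed from 1, and n, the number of rows, is needed only for the empty
  matrix \<open>hcat n V 0\<close>.\<close>

primrec hcat :: "nat \<Rightarrow> (nat \<Rightarrow> real mat) \<Rightarrow> nat \<Rightarrow> real mat" where
  "hcat n V 0 = 0\<^sub>m n 0"
| "hcat n V (Suc j) = append_cols (hcat n V j) (V (Suc j))"

text \<open>The blocks have size s by s: every block strictly below the first block
  subdiagonal vanishes.\<close>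

definition block_hessenberg :: "nat \<Rightarrow> real mat \<Rightarrow> bool" where
  "block_hessenberg s M \<longleftrightarrow>
     (\<forall>i < dim_row M. \<forall>j < dim_col M. i div s > j div s + 1 \<longrightarrow> M $$ (i, j) = 0)"

definition qr_factorization :: "nat \<Rightarrow> nat \<Rightarrow> real mat \<Rightarrow> real mat \<Rightarrow> real mat \<Rightarrow> bool" where
  "qr_factorization n s C V R \<longleftrightarrow>
     V \<in> carrier_mat n s \<and> col_orthonormal V \<and>
     R \<in> carrier_mat s s \<and> upper_triangular R \<and> C = V * R"

text \<open>Here \<open>H j\<close> is the block Hessenberg matrix with j+1 block rows and j block columns.\<close>

definition block_krylov ::
  "nat \<Rightarrow> nat \<Rightarrow> nat \<Rightarrow> real mat \<Rightarrow> real mat \<Rightarrow> (nat \<Rightarrow> real mat) \<Rightarrow> real mat \<Rightarrow> (nat \<Rightarrow> real mat) \<Rightarrow> bool"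
where
  "block_krylov n s N A C V R H \<longleftrightarrow>
     qr_factorization n s C (V 1) R \<and>
     (\<forall>j \<in> {1..N+1}. V j \<in> carrier_mat n s \<and> col_orthonormal (hcat n V j)) \<and>
     (\<forall>j \<in> {1..N}. H j \<in> carrier_mat ((j+1)*s) (j*s) \<and> block_hessenberg s (H j) \<and>
        A * hcat n V j = hcat n V (j+1) * H j)"

text \<open>The iterations are total functions, by the convention \<open>x / 0 = 0\<close>; they have their intended
  meaning as long as no division by zero occurs, see \<open>cg_no_breakdown\<close> and \<open>fcg_no_breakdown\<close>.\<close>

function
  cg_X :: "real mat \<Rightarrow> real mat \<Rightarrow> real mat \<Rightarrow> real mat \<Rightarrow> nat \<Rightarrow> real mat" and
  cg_R :: "real mat \<Rightarrow> real mat \<Rightarrow> real mat \<Rightarrow> real mat \<Rightarrow> nat \<Rightarrow> real mat" and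
  cg_P :: "real mat \<Rightarrow> real mat \<Rightarrow> real mat \<Rightarrow> real mat \<Rightarrow> nat \<Rightarrow> real mat" and
  cg_Q :: "real mat \<Rightarrow> real mat \<Rightarrow> real mat \<Rightarrow> real mat \<Rightarrow> nat \<Rightarrow> real mat" and
  cg_rho :: "real mat \<Rightarrow> real mat \<Rightarrow> real mat \<Rightarrow> real mat \<Rightarrow> nat \<Rightarrow> real" and
  cg_alpha :: "real mat \<Rightarrow> real mat \<Rightarrow> real mat \<Rightarrow> real mat \<Rightarrow> nat \<Rightarrow> real" and
  cg_beta :: "real mat \<Rightarrow> real mat \<Rightarrow> real mat \<Rightarrow> real mat \<Rightarrow> nat \<Rightarrow> real"
where
  "cg_X A B C1 C2 0 = 0\<^sub>m (dim_row A) (dim_row B)"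
| "cg_X A B C1 C2 (Suc k) = cg_X A B C1 C2 k + cg_alpha A B C1 C2 k \<cdot>\<^sub>m cg_P A B C1 C2 k"
| "cg_R A B C1 C2 0 = C1 * transpose_mat C2"
| "cg_R A B C1 C2 (Suc k) = cg_R A B C1 C2 k - cg_alpha A B C1 C2 k \<cdot>\<^sub>m cg_Q A B C1 C2 k"
| "cg_P A B C1 C2 0 = cg_R A B C1 C2 0"
| "cg_P A B C1 C2 (Suc k) =
     cg_R A B C1 C2 (Suc k) + cg_beta A B C1 C2 k \<cdot>\<^sub>m cg_P A B C1 C2 k"
| "cg_Q A B C1 C2 k = A * cg_P A B C1 C2 k + cg_P A B C1 C2 k * B"
| "cg_rho A B C1 C2 k = frob_inner (cg_R A B C1 C2 k) (cg_R A B C1 C2 k)"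
| "cg_alpha A B C1 C2 k =
     cg_rho A B C1 C2 k / frob_inner (cg_P A B C1 C2 k) (cg_Q A B C1 C2 k)"
| "cg_beta A B C1 C2 k = cg_rho A B C1 C2 (Suc k) / cg_rho A B C1 C2 k"
  by pat_completeness auto
termination
  by (relation "measure (\<lambda>x. case x of
        Inl (Inl (_, _, _, _, k)) \<Rightarrow> 8*k
      | Inl (Inr (Inl (_, _, _, _, k))) \<Rightarrow> 8*k
      | Inl (Inr (Inr (_, _, _, _, k))) \<Rightarrow> 8*k+3
      | Inr (Inl (Inl (_, _, _, _, k))) \<Rightarrow> 8*k+4
      | Inr (Inl (Inr (_, _, _, _, k))) \<Rightarrow> 8*k+1
      | Inr (Inr (Inl (_, _, _, _, k))) \<Rightarrow> 8*k+5
      | Inr (Inr (Inr (_, _, _, _, k))) \<Rightarrow> 8*k+10)") auto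

definition cg_no_breakdown ::
  "real mat \<Rightarrow> real mat \<Rightarrow> real mat \<Rightarrow> real mat \<Rightarrow> nat \<Rightarrow> bool" where
  "cg_no_breakdown A B C1 C2 N \<longleftrightarrow>
     (\<forall>k < N. frob_inner (cg_P A B C1 C2 k) (cg_Q A B C1 C2 k) \<noteq> 0 \<and> cg_rho A B C1 C2 k \<noteq> 0)"

text \<open>Here \<open>L\<close> and \<open>R\<close> are the triangular factors of the two QR factorizations.\<close>

definition pad :: "nat \<Rightarrow> real mat \<Rightarrow> real mat" where
  "pad s M = four_block_mat M (0\<^sub>m (dim_row M) s) (0\<^sub>m s (dim_col M)) (0\<^sub>m s s)"

definition leading_submatrix :: "nat \<Rightarrow> nat \<Rightarrow> real mat \<Rightarrow> real mat" where
  "leading_submatrix i j M = submatrix M {..<i} {..<j}"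

function
  fcg_X :: "nat \<Rightarrow> real mat \<Rightarrow> real mat \<Rightarrow> (nat \<Rightarrow> real mat) \<Rightarrow> (nat \<Rightarrow> real mat) \<Rightarrow> nat \<Rightarrow> real mat" and
  fcg_R :: "nat \<Rightarrow> real mat \<Rightarrow> real mat \<Rightarrow> (nat \<Rightarrow> real mat) \<Rightarrow> (nat \<Rightarrow> real mat) \<Rightarrow> nat \<Rightarrow> real mat" and
  fcg_P :: "nat \<Rightarrow> real mat \<Rightarrow> real mat \<Rightarrow> (nat \<Rightarrow> real mat) \<Rightarrow> (nat \<Rightarrow> real mat) \<Rightarrow> nat \<Rightarrow> real mat" and
  fcg_Q :: "nat \<Rightarrow> real mat \<Rightarrow> real mat \<Rightarrow> (nat \<Rightarrow> real mat) \<Rightarrow> (nat \<Rightarrow> real mat) \<Rightarrow> nat \<Rightarrow> real mat" and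
  fcg_rho :: "nat \<Rightarrow> real mat \<Rightarrow> real mat \<Rightarrow> (nat \<Rightarrow> real mat) \<Rightarrow> (nat \<Rightarrow> real mat) \<Rightarrow> nat \<Rightarrow> real" and
  fcg_alpha :: "nat \<Rightarrow> real mat \<Rightarrow> real mat \<Rightarrow> (nat \<Rightarrow> real mat) \<Rightarrow> (nat \<Rightarrow> real mat) \<Rightarrow> nat \<Rightarrow> real" and
  fcg_beta :: "nat \<Rightarrow> real mat \<Rightarrow> real mat \<Rightarrow> (nat \<Rightarrow> real mat) \<Rightarrow> (nat \<Rightarrow> real mat) \<Rightarrow> nat \<Rightarrow> real"
where
  "fcg_X s L R H G 0 = 0\<^sub>m 0 0"
| "fcg_X s L R H G (Suc k) =
     pad s (fcg_X s L R H G k) + fcg_alpha s L R H G k \<cdot>\<^sub>m fcg_P s L R H G k"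
| "fcg_R s L R H G 0 = L * transpose_mat R"
| "fcg_R s L R H G (Suc k) =
     pad s (fcg_R s L R H G k) - fcg_alpha s L R H G k \<cdot>\<^sub>m fcg_Q s L R H G k"
| "fcg_P s L R H G 0 = fcg_R s L R H G 0"
| "fcg_P s L R H G (Suc k) =
     fcg_R s L R H G (Suc k) + pad s (fcg_beta s L R H G k \<cdot>\<^sub>m fcg_P s L R H G k)"
| "fcg_Q s L R H G k =
     append_cols (H (k+1) * fcg_P s L R H G k) (0\<^sub>m ((k+2)*s) s)
     + ((fcg_P s L R H G k * transpose_mat (G (k+1))) @\<^sub>r 0\<^sub>m s ((k+2)*s))"
| "fcg_rho s L R H G k = frob_inner (fcg_R s L R H G k) (fcg_R s L R H G k)"
| "fcg_alpha s L R H G k =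
     fcg_rho s L R H G k /
       frob_inner (fcg_P s L R H G k)
         (leading_submatrix ((k+1)*s) ((k+1)*s) (fcg_Q s L R H G k))"
| "fcg_beta s L R H G k = fcg_rho s L R H G (Suc k) / fcg_rho s L R H G k"
  by pat_completeness auto
termination
  by (relation "measure (\<lambda>x. case x of
        Inl (Inl (_, _, _, _, _, k)) \<Rightarrow> 8*k
      | Inl (Inr (Inl (_, _, _, _, _, k))) \<Rightarrow> 8*k
      | Inl (Inr (Inr (_, _, _, _, _, k))) \<Rightarrow> 8*k+3
      | Inr (Inl (Inl (_, _, _, _, _, k))) \<Rightarrow> 8*k+4
      | Inr (Inl (Inr (_, _, _, _, _, k))) \<Rightarrow> 8*k+1
      | Inr (Inr (Inl (_, _, _, _, _, k))) \<Rightarrow> 8*k+5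
      | Inr (Inr (Inr (_, _, _, _, _, k))) \<Rightarrow> 8*k+10)") auto

definition fcg_no_breakdown ::
  "nat \<Rightarrow> real mat \<Rightarrow> real mat \<Rightarrow> (nat \<Rightarrow> real mat) \<Rightarrow> (nat \<Rightarrow> real mat) \<Rightarrow> nat \<Rightarrow> bool" where
  "fcg_no_breakdown s L R H G N \<longleftrightarrow>
     (\<forall>k < N. frob_inner (fcg_P s L R H G k)
                (leading_submatrix ((k+1)*s) ((k+1)*s) (fcg_Q s L R H G k)) \<noteq> 0
            \<and> fcg_rho s L R H G k \<noteq> 0)"

end

theory Submission
  imports Defs
begin

text \<open>
  Let \<open>U\<close> and \<open>Z\<close> have orthonormal columns. Then the map \<open>M \<mapsto> U M Z\<^sup>T\<close> is linear and
  preserves the Frobenius inner product (\<open>frob_inner_lift\<close>), because the trace is cyclic. With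
  \<open>U = \<V>\<^sub>k\<^sub>+\<^sub>1\<close> and \<open>Z = \<W>\<^sub>k\<^sub>+\<^sub>1\<close> the accumulated block Krylov bases, the claim is that this isometry
  carries the small iterates of the factorized method to the iterates of matrix-oriented CG.

  Enlarging the bases by one block is harmless: bordering the small matrix with zeros does not
  change its image (\<open>lift_pad\<close>), so the iterates of different sizes can be added once they are
  padded. The Krylov relations \<open>A \<V>\<^sub>j = \<V>\<^sub>j\<^sub>+\<^sub>1 H\<^sub>j\<close> and \<open>\<W>\<^sub>j\<^sup>T B = G\<^sub>j\<^sup>T \<W>\<^sub>j\<^sub>+\<^sub>1\<^sup>T\<close> turn the Sylvester operator
  into the formula that defines the small \<open>Q\<^sub>k\<close> (\<open>lift_sylvester\<close>). Finally the inner product of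
  the small \<open>P\<^sub>k\<close> with the leading block of the small \<open>Q\<^sub>k\<close> is that of the padded \<open>P\<^sub>k\<close> with all of
  \<open>Q\<^sub>k\<close> (\<open>frob_inner_pad\<close>), which the isometry identifies with the denominator of \<open>\<alpha>\<^sub>k\<close> in CG.
  Hence equal iterates give equal scalars and equal scalars give equal next iterates, and an
  induction on \<open>k\<close> finishes the proof. Since every inner product is transported exactly, so is
  the absence of vanishing denominators.
\<close>

section \<open>The Frobenius inner product\<close>

lemma mat_trace_comm:
  assumes X: "X \<in> carrier_mat p q" and Y: "Y \<in> carrier_mat q p"
  shows "mat_trace (X * Y) = mat_trace (Y * X)"
proof -
  have "mat_trace (X * Y) = (\<Sum>i<p. \<Sum>j<q. X $$ (i, j) * Y $$ (j, i))"
    using X Y by (simp add: mat_trace_def scalar_prod_def atLeast0LessThan)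
  also have "\<dots> = (\<Sum>j<q. \<Sum>i<p. X $$ (i, j) * Y $$ (j, i))"
    by (rule sum.swap)
  also have "\<dots> = mat_trace (Y * X)"
    using X Y by (simp add: mat_trace_def scalar_prod_def atLeast0LessThan mult.commute)
  finally show ?thesis .
qed

lemma frob_inner_entries:
  assumes "X \<in> carrier_mat p q" and "Y \<in> carrier_mat p q"
  shows "frob_inner X Y = (\<Sum>j<q. \<Sum>i<p. X $$ (i, j) * Y $$ (i, j))"
  using assms by (simp add: frob_inner_def mat_trace_def scalar_prod_def atLeast0LessThan)

lemma frob_inner_lift:
  assumes U: "U \<in> carrier_mat n p" and Z: "Z \<in> carrier_mat m q"
    and X: "X \<in> carrier_mat p q" and Y: "Y \<in> carrier_mat p q"
    and orthU: "col_orthonormal U" and orthZ: "col_orthonormal Z"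
  shows "frob_inner (U * X * transpose_mat Z) (U * Y * transpose_mat Z) = frob_inner X Y"
proof -
  have UU: "transpose_mat U * U = 1\<^sub>m p" and ZZ: "transpose_mat Z * Z = 1\<^sub>m q"
    using orthU orthZ U Z by (auto simp: col_orthonormal_def)
  let ?T = "transpose_mat X * Y * transpose_mat Z"
  have Ut: "transpose_mat U \<in> carrier_mat p n" and Zt: "transpose_mat Z \<in> carrier_mat q m"
    and Xt: "transpose_mat X \<in> carrier_mat q p"
    using U Z X by auto
  have T: "?T \<in> carrier_mat q m" using Xt Y Zt by auto
  have YZ: "Y * transpose_mat Z \<in> carrier_mat p m" using Y Zt by auto
  have "transpose_mat (U * X * transpose_mat Z) = Z * (transpose_mat X * transpose_mat U)"
    using transpose_mult[OF mult_carrier_mat[OF U X] Zt] transpose_mult[OF U X] by simp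
  then have "transpose_mat (U * X * transpose_mat Z) * (U * Y * transpose_mat Z)
      = Z * (transpose_mat X * transpose_mat U) * (U * (Y * transpose_mat Z))"
    using U Y Zt by (simp add: assoc_mult_mat[where ?n\<^sub>2.0 = p])
  also have "\<dots> = Z * (transpose_mat X * (transpose_mat U * (U * (Y * transpose_mat Z))))"
    using assoc_mult_mat[OF Z mult_carrier_mat[OF Xt Ut] mult_carrier_mat[OF U YZ]]
      assoc_mult_mat[OF Xt Ut mult_carrier_mat[OF U YZ]] by simp
  also have "transpose_mat U * (U * (Y * transpose_mat Z)) = Y * transpose_mat Z"
    using assoc_mult_mat[OF Ut U YZ] UU left_mult_one_mat[OF YZ] by simp
  also have "transpose_mat X * (Y * transpose_mat Z) = ?T"
    using assoc_mult_mat[OF Xt Y Zt] by simp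
  finally have "frob_inner (U * X * transpose_mat Z) (U * Y * transpose_mat Z) = mat_trace (Z * ?T)"
    by (simp add: frob_inner_def)
  also have "\<dots> = mat_trace (?T * Z)" by (rule mat_trace_comm[OF Z T])
  also have "?T * Z = transpose_mat X * Y"
    using assoc_mult_mat[OF mult_carrier_mat[OF Xt Y] Zt Z] ZZ Xt Y by simp
  finally show ?thesis by (simp add: frob_inner_def)
qed

section \<open>Padding and appending blocks\<close>

lemma append_cols_carrier:
  assumes "M \<in> carrier_mat p q" and "M' \<in> carrier_mat p s"
  shows "append_cols M M' \<in> carrier_mat p (q + s)"
  unfolding append_cols_def carrier_mat_def using assms by simp

lemma pad_carrier: "M \<in> carrier_mat p q \<Longrightarrow> pad s M \<in> carrier_mat (p + s) (q + s)"
  unfolding pad_def carrier_mat_def by simp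

lemma append_cols_mult_append_zero_rows:
  assumes U: "U \<in> carrier_mat n p" and U': "U' \<in> carrier_mat n s" and M: "M \<in> carrier_mat p q"
  shows "append_cols U U' * (M @\<^sub>r 0\<^sub>m s q) = U * M"
proof -
  have "append_cols U U' * (M @\<^sub>r 0\<^sub>m s q) = four_block_mat U U' (0\<^sub>m 0 p) (0\<^sub>m 0 s)
      * four_block_mat M (0\<^sub>m p 0) (0\<^sub>m s q) (0\<^sub>m s 0)"
    using assms by (simp add: append_cols_def append_rows_def)
  also have "\<dots> = four_block_mat (U * M + U' * 0\<^sub>m s q) (U * 0\<^sub>m p 0 + U' * 0\<^sub>m s 0)
      (0\<^sub>m 0 p * M + 0\<^sub>m 0 s * 0\<^sub>m s q) (0\<^sub>m 0 p * 0\<^sub>m p 0 + 0\<^sub>m 0 s * 0\<^sub>m s 0)"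
    by (rule mult_four_block_mat) (use assms in auto)
  also have "\<dots> = U * M"
    using assms by (intro eq_matI) auto
  finally show ?thesis .
qed

lemma transpose_append_cols_zero:
  assumes "M \<in> carrier_mat p q"
  shows "transpose_mat (append_cols M (0\<^sub>m p s)) = transpose_mat M @\<^sub>r 0\<^sub>m s p"
  using assms by (intro eq_matI) (auto simp: append_cols_def append_rows_def)

text \<open>This is \<open>append_cols_mult_append_zero_rows\<close> transposed.\<close>

lemma append_zero_cols_mult_transpose:
  assumes Z: "Z \<in> carrier_mat m q" and Z': "Z' \<in> carrier_mat m s" and M: "M \<in> carrier_mat p q"
  shows "append_cols M (0\<^sub>m p s) * transpose_mat (append_cols Z Z') = M * transpose_mat Z"
proof -
  have MO: "append_cols M (0\<^sub>m p s) \<in> carrier_mat p (q + s)"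
    and ZZ: "append_cols Z Z' \<in> carrier_mat m (q + s)"
    using append_cols_carrier[of M p q "0\<^sub>m p s" s] append_cols_carrier[OF Z Z'] M by auto
  have "append_cols Z Z' * (transpose_mat M @\<^sub>r 0\<^sub>m s p) = Z * transpose_mat M"
    by (rule append_cols_mult_append_zero_rows[OF Z Z']) (use M in simp)
  then have "transpose_mat (append_cols Z Z' * transpose_mat (append_cols M (0\<^sub>m p s)))
      = transpose_mat (Z * transpose_mat M)"
    by (simp add: transpose_append_cols_zero[OF M])
  then show ?thesis
    using transpose_mult[OF ZZ, of "transpose_mat (append_cols M (0\<^sub>m p s))" p]
      transpose_mult[OF Z, of "transpose_mat M" p] MO M by simp
qed

lemma pad_eq_append:
  assumes "M \<in> carrier_mat p q"
  shows "pad s M = append_cols (M @\<^sub>r 0\<^sub>m s q) (0\<^sub>m (p + s) s)"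
  using assms by (intro eq_matI) (auto simp: pad_def append_cols_def append_rows_def)

text \<open>The new basis blocks only ever meet the zero border.\<close>

lemma lift_pad:
  assumes U: "U \<in> carrier_mat n p" and U': "U' \<in> carrier_mat n s"
    and Z: "Z \<in> carrier_mat m q" and Z': "Z' \<in> carrier_mat m s"
    and M: "M \<in> carrier_mat p q"
  shows "append_cols U U' * pad s M * transpose_mat (append_cols Z Z') = U * M * transpose_mat Z"
proof -
  have UU: "append_cols U U' \<in> carrier_mat n (p + s)" by (rule append_cols_carrier[OF U U'])
  have ZZ: "transpose_mat (append_cols Z Z') \<in> carrier_mat (q + s) m"
    using append_cols_carrier[OF Z Z'] by simp
  have MO: "M @\<^sub>r 0\<^sub>m s q \<in> carrier_mat (p + s) q" using M by auto
  have Zt: "transpose_mat Z \<in> carrier_mat q m" using Z by simp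
  have "append_cols U U' * pad s M * transpose_mat (append_cols Z Z')
      = append_cols U U' * (pad s M * transpose_mat (append_cols Z Z'))"
    by (rule assoc_mult_mat[OF UU pad_carrier[OF M] ZZ])
  also have "\<dots> = append_cols U U' * ((M @\<^sub>r 0\<^sub>m s q) * transpose_mat Z)"
    by (simp add: pad_eq_append[OF M] append_zero_cols_mult_transpose[OF Z Z' MO])
  also have "\<dots> = append_cols U U' * (M @\<^sub>r 0\<^sub>m s q) * transpose_mat Z"
    by (rule assoc_mult_mat[OF UU MO Zt, symmetric])
  finally show ?thesis by (simp add: append_cols_mult_append_zero_rows[OF U U' M])
qed

lemma pick_lessThan:
  assumes "k < i"
  shows "pick {..<i} k = k"
proof -
  have "{a \<in> {..<i}. a < k} = {..<k}" using assms by auto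
  then show ?thesis using pick_card_in_set[of k "{..<i}"] assms by simp
qed

lemma leading_submatrix_eq:
  assumes "M \<in> carrier_mat p q" and "i \<le> p" and "j \<le> q"
  shows "leading_submatrix i j M = mat i j (\<lambda>ij. M $$ ij)"
proof -
  have "{a. a < p \<and> a < i} = {..<i}" and "{b. b < q \<and> b < j} = {..<j}"
    using assms by auto
  then show ?thesis
    using assms by (intro eq_matI) (auto simp: leading_submatrix_def submatrix_def pick_lessThan)
qed

lemma frob_inner_pad:
  assumes M: "M \<in> carrier_mat p q" and Q: "Q \<in> carrier_mat (p + s) (q + s)"
  shows "frob_inner (pad s M) Q = frob_inner M (leading_submatrix p q Q)"
proof -
  have L: "leading_submatrix p q Q = mat p q (\<lambda>ij. Q $$ ij)"
    by (rule leading_submatrix_eq[OF Q]) auto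
  have ent: "pad s M $$ (i, j) = (if i < p \<and> j < q then M $$ (i, j) else 0)"
    if "i < p + s" "j < q + s" for i j
    using that M by (auto simp: pad_def)
  have "frob_inner (pad s M) Q = (\<Sum>j<q+s. \<Sum>i<p+s. pad s M $$ (i, j) * Q $$ (i, j))"
    by (rule frob_inner_entries[OF pad_carrier[OF M] Q])
  also have "\<dots> = (\<Sum>j<q+s. \<Sum>i<p+s. if i < p \<and> j < q then M $$ (i, j) * Q $$ (i, j) else 0)"
    by (intro sum.cong refl) (auto simp: ent)
  also have "\<dots> = (\<Sum>j<q. \<Sum>i<p+s. if i < p \<and> j < q then M $$ (i, j) * Q $$ (i, j) else 0)"
    by (intro sum.mono_neutral_right) auto
  also have "\<dots> = (\<Sum>j<q. \<Sum>i<p. M $$ (i, j) * Q $$ (i, j))"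
    by (intro sum.cong refl sum.mono_neutral_cong_right) auto
  also have "\<dots> = frob_inner M (leading_submatrix p q Q)"
    by (subst frob_inner_entries[OF M, of "leading_submatrix p q Q"]) (auto simp: L)
  finally show ?thesis .
qed

section \<open>Linearity of the lift and the Sylvester operator\<close>

lemma lift_add:
  fixes U X Y Z :: "real mat"
  assumes U: "U \<in> carrier_mat n p" and Z: "Z \<in> carrier_mat m q"
    and X: "X \<in> carrier_mat p q" and Y: "Y \<in> carrier_mat p q"
  shows "U * (X + Y) * transpose_mat Z = U * X * transpose_mat Z + U * Y * transpose_mat Z"
proof -
  have Zt: "transpose_mat Z \<in> carrier_mat q m" using Z by simp
  show ?thesis
    using mult_add_distrib_mat[OF U X Y]
      add_mult_distrib_mat[OF mult_carrier_mat[OF U X] mult_carrier_mat[OF U Y] Zt] by simp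
qed

lemma lift_smult:
  fixes U X Z :: "real mat"
  assumes U: "U \<in> carrier_mat n p" and Z: "Z \<in> carrier_mat m q" and X: "X \<in> carrier_mat p q"
  shows "U * (c \<cdot>\<^sub>m X) * transpose_mat Z = c \<cdot>\<^sub>m (U * X * transpose_mat Z)"
proof -
  have Zt: "transpose_mat Z \<in> carrier_mat q m" using Z by simp
  show ?thesis
    using mult_smult_distrib[OF U X] mult_smult_assoc_mat[OF mult_carrier_mat[OF U X] Zt] by simp
qed

lemma lift_diff:
  fixes U X Y Z :: "real mat"
  assumes U: "U \<in> carrier_mat n p" and Z: "Z \<in> carrier_mat m q"
    and X: "X \<in> carrier_mat p q" and Y: "Y \<in> carrier_mat p q"
  shows "U * (X - Y) * transpose_mat Z = U * X * transpose_mat Z - U * Y * transpose_mat Z"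
proof -
  have Zt: "transpose_mat Z \<in> carrier_mat q m" using Z by simp
  show ?thesis
    using mult_minus_distrib_mat[OF U X Y]
      minus_mult_distrib_mat[OF mult_carrier_mat[OF U X] mult_carrier_mat[OF U Y] Zt] by simp
qed

text \<open>Applying \<open>A\<close> moves the left factor one step up the Krylov hierarchy while the right factor
  stays; the zero columns compensate by discarding the last block of \<open>append_cols Z Z'\<close>.
  Symmetrically for \<open>B\<close>.\<close>

lemma lift_sylvester:
  assumes A: "A \<in> carrier_mat n n" and B: "B \<in> carrier_mat m m"
    and U: "U \<in> carrier_mat n p" and U': "U' \<in> carrier_mat n s"
    and Z: "Z \<in> carrier_mat m q" and Z': "Z' \<in> carrier_mat m s"
    and P: "P \<in> carrier_mat p q"
    and H: "H \<in> carrier_mat (p + s) p" and AU: "A * U = append_cols U U' * H"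
    and G: "G \<in> carrier_mat (q + s) q"
    and BZ: "transpose_mat B * Z = append_cols Z Z' * G"
  shows "append_cols U U'
      * (append_cols (H * P) (0\<^sub>m (p + s) s) + ((P * transpose_mat G) @\<^sub>r 0\<^sub>m s (q + s)))
      * transpose_mat (append_cols Z Z')
    = A * (U * P * transpose_mat Z) + (U * P * transpose_mat Z) * B"
proof -
  let ?U = "append_cols U U'" and ?Z = "append_cols Z Z'"
  have U2: "?U \<in> carrier_mat n (p + s)" by (rule append_cols_carrier[OF U U'])
  have Z2: "?Z \<in> carrier_mat m (q + s)" by (rule append_cols_carrier[OF Z Z'])
  have Zt: "transpose_mat Z \<in> carrier_mat q m" and Z2t: "transpose_mat ?Z \<in> carrier_mat (q + s) m"
    and Gt: "transpose_mat G \<in> carrier_mat q (q + s)"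
    using Z Z2 G by auto
  have HP: "H * P \<in> carrier_mat (p + s) q" and PG: "P * transpose_mat G \<in> carrier_mat p (q + s)"
    and UP: "U * P \<in> carrier_mat n q"
    using H P Gt U by auto
  have L: "append_cols (H * P) (0\<^sub>m (p + s) s) \<in> carrier_mat (p + s) (q + s)"
    by (rule append_cols_carrier[OF HP]) simp
  have R: "(P * transpose_mat G) @\<^sub>r 0\<^sub>m s (q + s) \<in> carrier_mat (p + s) (q + s)"
    using PG by auto
  have BZt: "transpose_mat Z * B = transpose_mat G * transpose_mat ?Z"
    using arg_cong[OF BZ, of transpose_mat] transpose_mult[OF Z2 G]
      transpose_mult[of "transpose_mat B" m m Z q] B Z by simp
  have "?U * append_cols (H * P) (0\<^sub>m (p + s) s) * transpose_mat ?Z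
      = ?U * (append_cols (H * P) (0\<^sub>m (p + s) s) * transpose_mat ?Z)"
    by (rule assoc_mult_mat[OF U2 L Z2t])
  also have "\<dots> = ?U * (H * P * transpose_mat Z)"
    by (simp add: append_zero_cols_mult_transpose[OF Z Z' HP])
  also have "\<dots> = ?U * H * P * transpose_mat Z"
    using assoc_mult_mat[OF U2 HP Zt] assoc_mult_mat[OF U2 H P] by simp
  also have "\<dots> = A * (U * P * transpose_mat Z)"
    using assoc_mult_mat[OF A U P] assoc_mult_mat[OF A UP Zt] by (simp flip: AU)
  finally have left: "?U * append_cols (H * P) (0\<^sub>m (p + s) s) * transpose_mat ?Z
      = A * (U * P * transpose_mat Z)" .
  have "?U * ((P * transpose_mat G) @\<^sub>r 0\<^sub>m s (q + s)) * transpose_mat ?Z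
      = U * (P * transpose_mat G) * transpose_mat ?Z"
    by (simp add: append_cols_mult_append_zero_rows[OF U U' PG])
  also have "\<dots> = U * P * (transpose_mat G * transpose_mat ?Z)"
    using assoc_mult_mat[OF U P Gt] assoc_mult_mat[OF UP Gt Z2t] by simp
  also have "\<dots> = U * P * transpose_mat Z * B"
    using assoc_mult_mat[OF UP Zt B] by (simp flip: BZt)
  finally show ?thesis
    using left lift_add[OF U2 Z2 L R] by simp
qed

section \<open>Transporting the iteration\<close>

text \<open>The rules for \<open>cg_Q\<close>, \<open>cg_rho\<close>, \<open>cg_alpha\<close>, \<open>cg_beta\<close> and for their factorized
  counterparts apply to a variable index, so the simplifier would expand the whole history of
  the iteration.\<close>

declare cg_X.simps [simp del] cg_R.simps [simp del] cg_P.simps [simp del] cg_Q.simps [simp del]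
  cg_rho.simps [simp del] cg_alpha.simps [simp del] cg_beta.simps [simp del]
  fcg_X.simps [simp del] fcg_R.simps [simp del] fcg_P.simps [simp del] fcg_Q.simps [simp del]
  fcg_rho.simps [simp del] fcg_alpha.simps [simp del] fcg_beta.simps [simp del]

lemma block_krylov_hcat_carrier:
  assumes "block_krylov n s N A C V R H" and "j \<le> N + 1"
  shows "hcat n V j \<in> carrier_mat n (j * s)"
  using assms(2)
proof (induction j)
  case (Suc j)
  then have "V (Suc j) \<in> carrier_mat n s" using assms(1) by (auto simp: block_krylov_def)
  with Suc show ?case using append_cols_carrier[of "hcat n V j" n "j * s" "V (Suc j)" s]
    by (simp add: add.commute)
qed simp

lemma block_krylov_step:
  assumes "block_krylov n s N A C V R H" and k: "k < N"
  shows "H (Suc k) \<in> carrier_mat (Suc k * s + s) (Suc k * s)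
    \<and> A * hcat n V (Suc k) = append_cols (hcat n V (Suc k)) (V (Suc (Suc k))) * H (Suc k)"
proof -
  have step: "\<forall>j\<in>{1..N}. H j \<in> carrier_mat ((j+1)*s) (j*s)
      \<and> A * hcat n V j = hcat n V (j+1) * H j"
    using assms(1) by (simp only: block_krylov_def) blast
  have "Suc k \<in> {1..N}" and "(Suc k + 1) * s = Suc k * s + s" using k by auto
  then show ?thesis using bspec[OF step, of "Suc k"]
    by (simp only: hcat.simps(2)[of n V "Suc k"] Suc_eq_plus1[symmetric])
qed

locale krylov_pair =
  fixes n m s N :: nat and A B C1 C2 RL RR :: "real mat" and V W H G :: "nat \<Rightarrow> real mat"
  assumes A_carrier: "A \<in> carrier_mat n n" and B_carrier: "B \<in> carrier_mat m m"
    and left: "block_krylov n s N A C1 V RL H"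
    and right: "block_krylov m s N (transpose_mat B) C2 W RR G"
begin

abbreviation "VV \<equiv> hcat n V"
abbreviation "WW \<equiv> hcat m W"
abbreviation "X \<equiv> cg_X A B C1 C2"
abbreviation "R \<equiv> cg_R A B C1 C2"
abbreviation "P \<equiv> cg_P A B C1 C2"
abbreviation "Q \<equiv> cg_Q A B C1 C2"
abbreviation "\<rho> \<equiv> cg_rho A B C1 C2"
abbreviation "\<alpha> \<equiv> cg_alpha A B C1 C2"
abbreviation "\<beta> \<equiv> cg_beta A B C1 C2"
abbreviation "Xf \<equiv> fcg_X s RL RR H G"
abbreviation "Rf \<equiv> fcg_R s RL RR H G"
abbreviation "Pf \<equiv> fcg_P s RL RR H G"
abbreviation "Qf \<equiv> fcg_Q s RL RR H G"
abbreviation "\<rho>f \<equiv> fcg_rho s RL RR H G"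
abbreviation "\<alpha>f \<equiv> fcg_alpha s RL RR H G"
abbreviation "\<beta>f \<equiv> fcg_beta s RL RR H G"

lemma VV_carrier: "j \<le> N + 1 \<Longrightarrow> VV j \<in> carrier_mat n (j * s)"
  and WW_carrier: "j \<le> N + 1 \<Longrightarrow> WW j \<in> carrier_mat m (j * s)"
  using block_krylov_hcat_carrier[OF left] block_krylov_hcat_carrier[OF right] by auto

lemma V_carrier: "j < N + 1 \<Longrightarrow> V (Suc j) \<in> carrier_mat n s"
  and W_carrier: "j < N + 1 \<Longrightarrow> W (Suc j) \<in> carrier_mat m s"
  using left right by (auto simp: block_krylov_def)

lemma VV_orthonormal: "k < N + 1 \<Longrightarrow> col_orthonormal (VV (Suc k))"
  and WW_orthonormal: "k < N + 1 \<Longrightarrow> col_orthonormal (WW (Suc k))"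
  using left right by (auto simp: block_krylov_def simp del: hcat.simps)

lemma H_carrier: "k < N \<Longrightarrow> H (Suc k) \<in> carrier_mat (Suc k * s + s) (Suc k * s)"
  and A_VV: "k < N \<Longrightarrow> A * VV (Suc k) = append_cols (VV (Suc k)) (V (Suc (Suc k))) * H (Suc k)"
  using block_krylov_step[OF left] by blast+

lemma G_carrier: "k < N \<Longrightarrow> G (Suc k) \<in> carrier_mat (Suc k * s + s) (Suc k * s)"
  and B_WW: "k < N \<Longrightarrow>
    transpose_mat B * WW (Suc k) = append_cols (WW (Suc k)) (W (Suc (Suc k))) * G (Suc k)"
  using block_krylov_step[OF right] by blast+

lemma lift_pad_VV:
  assumes "j < N + 1" and "M \<in> carrier_mat (j * s) (j * s)"
  shows "VV (Suc j) * pad s M * transpose_mat (WW (Suc j)) = VV j * M * transpose_mat (WW j)"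
  using lift_pad[OF VV_carrier[of j] V_carrier[of j] WW_carrier[of j] W_carrier[of j], of M] assms
  by simp

lemma pad_carrier_block:
  "M \<in> carrier_mat (j * s) (j * s) \<Longrightarrow> pad s M \<in> carrier_mat (Suc j * s) (Suc j * s)"
  using pad_carrier[of M "j * s" "j * s" s] by (simp add: add.commute)

lemma Qf_carrier:
  assumes "k < N" and "Pf k \<in> carrier_mat (Suc k * s) (Suc k * s)"
  shows "Qf k \<in> carrier_mat (Suc (Suc k) * s) (Suc (Suc k) * s)"
proof -
  have c: "Suc (Suc k) * s = Suc k * s + s" by simp
  have "(Pf k * transpose_mat (G (Suc k))) @\<^sub>r 0\<^sub>m s (Suc k * s + s)
      \<in> carrier_mat (Suc k * s + s) (Suc k * s + s)"
    using assms G_carrier[OF assms(1)] by (intro carrier_append_rows) auto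
  then show ?thesis
    by (simp add: fcg_Q.simps c[symmetric] del: mult_Suc)
qed

lemma Q_lift:
  assumes k: "k < N" and Pc: "Pf k \<in> carrier_mat (Suc k * s) (Suc k * s)"
    and Pk: "P k = VV (Suc k) * Pf k * transpose_mat (WW (Suc k))"
  shows "Q k = VV (Suc (Suc k)) * Qf k * transpose_mat (WW (Suc (Suc k)))"
proof -
  have c: "(k + 2) * s = Suc k * s + s" by simp
  show ?thesis
    using lift_sylvester[OF A_carrier B_carrier VV_carrier V_carrier WW_carrier W_carrier Pc
        H_carrier[OF k] A_VV[OF k] G_carrier[OF k] B_WW[OF k]] k
    by (simp only: cg_Q.simps fcg_Q.simps Pk c hcat.simps) simp
qed

lemma P_Q_inner:
  assumes k: "k < N" and Pc: "Pf k \<in> carrier_mat (Suc k * s) (Suc k * s)"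
    and Pk: "P k = VV (Suc k) * Pf k * transpose_mat (WW (Suc k))"
  shows "frob_inner (P k) (Q k)
    = frob_inner (Pf k) (leading_submatrix ((k+1)*s) ((k+1)*s) (Qf k))"
proof -
  let ?V = "VV (Suc (Suc k))" and ?W = "WW (Suc (Suc k))"
  have Qc: "Qf k \<in> carrier_mat (Suc (Suc k) * s) (Suc (Suc k) * s)"
    by (rule Qf_carrier[OF k Pc])
  have "P k = ?V * pad s (Pf k) * transpose_mat ?W"
    using lift_pad_VV[OF _ Pc] k Pk by simp
  then have "frob_inner (P k) (Q k) = frob_inner (pad s (Pf k)) (Qf k)"
    using frob_inner_lift[OF VV_carrier WW_carrier pad_carrier_block[OF Pc] Qc
        VV_orthonormal WW_orthonormal] k by (simp add: Q_lift[OF k Pc Pk])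
  also have "\<dots> = frob_inner (Pf k) (leading_submatrix (Suc k * s) (Suc k * s) (Qf k))"
    by (rule frob_inner_pad[OF Pc]) (use Qc in \<open>simp add: add.commute\<close>)
  finally show ?thesis by simp
qed

lemma \<rho>_lift:
  assumes "k \<le> N" and "Rf k \<in> carrier_mat (Suc k * s) (Suc k * s)"
    and "R k = VV (Suc k) * Rf k * transpose_mat (WW (Suc k))"
  shows "\<rho>f k = \<rho> k"
  using frob_inner_lift[OF VV_carrier WW_carrier assms(2,2) VV_orthonormal WW_orthonormal]
    assms by (simp add: cg_rho.simps fcg_rho.simps)

lemma \<alpha>_lift:
  assumes "k < N" and "\<rho>f k = \<rho> k" and "Pf k \<in> carrier_mat (Suc k * s) (Suc k * s)"
    and "P k = VV (Suc k) * Pf k * transpose_mat (WW (Suc k))"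
  shows "\<alpha>f k = \<alpha> k"
  using P_Q_inner[OF assms(1,3,4)] assms(2) by (simp add: cg_alpha.simps fcg_alpha.simps)

text \<open>The sizes of the small iterates are part of the induction because the algebra of matrices
  holds only for matching sizes. At \<open>k = 0\<close> the basis is the empty matrix \<open>0\<^sub>m n 0\<close> and the lift
  of \<open>Xf 0\<close> is the zero matrix, so the identity for \<open>X\<close> can join the induction from the start.\<close>

lemma iterates_lift:
  assumes "k \<le> N"
  shows "Xf k \<in> carrier_mat (k * s) (k * s) \<and> X k = VV k * Xf k * transpose_mat (WW k)
    \<and> Rf k \<in> carrier_mat (Suc k * s) (Suc k * s)
    \<and> R k = VV (Suc k) * Rf k * transpose_mat (WW (Suc k))
    \<and> Pf k \<in> carrier_mat (Suc k * s) (Suc k * s)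
    \<and> P k = VV (Suc k) * Pf k * transpose_mat (WW (Suc k))"
  using assms
proof (induction k)
  case 0
  have qrL: "V 1 \<in> carrier_mat n s" "RL \<in> carrier_mat s s" "C1 = V 1 * RL"
    and qrR: "W 1 \<in> carrier_mat m s" "RR \<in> carrier_mat s s" "C2 = W 1 * RR"
    using left right by (auto simp: block_krylov_def qr_factorization_def)
  have first: "hcat r Y (Suc 0) = Y 1" if "Y 1 \<in> carrier_mat r s" for r and Y :: "nat \<Rightarrow> real mat"
    using that by (intro eq_matI) (auto simp: append_cols_def)
  have W1t: "transpose_mat (W 1) \<in> carrier_mat s m" and RRt: "transpose_mat RR \<in> carrier_mat s s"
    using qrR by auto
  have "C1 * transpose_mat C2 = V 1 * RL * (transpose_mat RR * transpose_mat (W 1))"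
    unfolding qrL(3) qrR(3) by (subst transpose_mult[OF qrR(1,2)]) (rule refl)
  also have "\<dots> = V 1 * (RL * transpose_mat RR) * transpose_mat (W 1)"
    using assoc_mult_mat[OF mult_carrier_mat[OF qrL(1,2)] RRt W1t]
      assoc_mult_mat[OF qrL(1,2) RRt] by simp
  finally have R0: "R 0 = VV (Suc 0) * Rf 0 * transpose_mat (WW (Suc 0))"
    by (simp only: cg_R.simps fcg_R.simps first[of V n, OF qrL(1)] first[of W m, OF qrR(1)])
  have X0: "X 0 = VV 0 * Xf 0 * transpose_mat (WW 0)"
    using A_carrier B_carrier by (auto simp: cg_X.simps fcg_X.simps)
  have Rc: "Rf 0 \<in> carrier_mat (Suc 0 * s) (Suc 0 * s)" using qrL qrR by (simp add: fcg_R.simps)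
  show ?case
    using R0 X0 Rc unfolding cg_P.simps fcg_P.simps by (simp add: fcg_X.simps)
next
  case (Suc k)
  then have k: "k < N" and Xc: "Xf k \<in> carrier_mat (k * s) (k * s)"
    and Xk: "X k = VV k * Xf k * transpose_mat (WW k)"
    and Rc: "Rf k \<in> carrier_mat (Suc k * s) (Suc k * s)"
    and Rk: "R k = VV (Suc k) * Rf k * transpose_mat (WW (Suc k))"
    and Pc: "Pf k \<in> carrier_mat (Suc k * s) (Suc k * s)"
    and Pk: "P k = VV (Suc k) * Pf k * transpose_mat (WW (Suc k))"
    by auto
  note V1 = VV_carrier[of "Suc k"] and W1 = WW_carrier[of "Suc k"]
  note V2 = VV_carrier[of "Suc (Suc k)"] and W2 = WW_carrier[of "Suc (Suc k)"]
  have Qc: "Qf k \<in> carrier_mat (Suc (Suc k) * s) (Suc (Suc k) * s)"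
    by (rule Qf_carrier[OF k Pc])
  have rho: "\<rho>f k = \<rho> k" using \<rho>_lift[OF _ Rc Rk] k by simp
  have alpha: "\<alpha>f k = \<alpha> k" by (rule \<alpha>_lift[OF k rho Pc Pk])
  have Xc': "Xf (Suc k) \<in> carrier_mat (Suc k * s) (Suc k * s)"
    unfolding fcg_X.simps by (intro add_carrier_mat smult_carrier_mat Pc)
  have X': "X (Suc k) = VV (Suc k) * Xf (Suc k) * transpose_mat (WW (Suc k))"
    using lift_add[OF V1 W1 pad_carrier_block[OF Xc] smult_carrier_mat[OF Pc]]
      lift_smult[OF V1 W1 Pc] lift_pad_VV[OF _ Xc] k
    by (simp only: cg_X.simps fcg_X.simps alpha Xk Pk)
  have Rc': "Rf (Suc k) \<in> carrier_mat (Suc (Suc k) * s) (Suc (Suc k) * s)"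
    unfolding fcg_R.simps by (intro minus_carrier_mat smult_carrier_mat Qc)
  have R': "R (Suc k) = VV (Suc (Suc k)) * Rf (Suc k) * transpose_mat (WW (Suc (Suc k)))"
    using lift_diff[OF V2 W2 pad_carrier_block[OF Rc] smult_carrier_mat[OF Qc]]
      lift_smult[OF V2 W2 Qc] lift_pad_VV[OF _ Rc] k
    by (simp only: cg_R.simps(2) fcg_R.simps(2) alpha Rk Q_lift[OF k Pc Pk])
  have "\<rho>f (Suc k) = \<rho> (Suc k)" using \<rho>_lift[OF _ Rc' R'] k by simp
  then have beta: "\<beta>f k = \<beta> k" by (simp only: cg_beta.simps fcg_beta.simps rho)
  have bPc: "\<beta> k \<cdot>\<^sub>m Pf k \<in> carrier_mat (Suc k * s) (Suc k * s)" using Pc by simp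
  have Pc': "Pf (Suc k) \<in> carrier_mat (Suc (Suc k) * s) (Suc (Suc k) * s)"
    unfolding fcg_P.simps beta by (intro add_carrier_mat pad_carrier_block bPc)
  have P': "P (Suc k) = VV (Suc (Suc k)) * Pf (Suc k) * transpose_mat (WW (Suc (Suc k)))"
    using lift_add[OF V2 W2 Rc' pad_carrier_block[OF bPc]]
      lift_smult[OF V1 W1 Pc] lift_pad_VV[OF _ bPc] k
    by (simp only: cg_P.simps(2) fcg_P.simps(2) beta R' Pk)
  show ?case using Xc' X' Rc' R' Pc' P' by blast
qed

end

theorem mainTheorem4:
  fixes n m s N :: nat
    and A B C1 C2 RL RR :: "real mat"
    and V W H G :: "nat \<Rightarrow> real mat"
  assumes A: "sym_pos_def n A"
    and B: "sym_pos_def m B"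
    and C1: "C1 \<in> carrier_mat n s"
    and C2: "C2 \<in> carrier_mat m s"
    and N: "N \<ge> 1"
    and left_basis: "block_krylov n s N A C1 V RL H"
    and right_basis: "block_krylov m s N (transpose_mat B) C2 W RR G"
    and cg: "cg_no_breakdown A B C1 C2 N"
  shows "fcg_no_breakdown s RL RR H G N
    \<and> (\<forall>k<N. fcg_alpha s RL RR H G k = cg_alpha A B C1 C2 k
            \<and> fcg_beta s RL RR H G k = cg_beta A B C1 C2 k)
    \<and> (\<forall>k\<le>N. fcg_rho s RL RR H G k = cg_rho A B C1 C2 k)
    \<and> cg_X A B C1 C2 0 = 0\<^sub>m n m
    \<and> (\<forall>k\<in>{1..N}. cg_X A B C1 C2 k =
          hcat n V k * fcg_X s RL RR H G k * transpose_mat (hcat m W k))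
    \<and> (\<forall>k\<le>N. cg_R A B C1 C2 k =
          hcat n V (k+1) * fcg_R s RL RR H G k * transpose_mat (hcat m W (k+1)))
    \<and> (\<forall>k\<le>N. cg_P A B C1 C2 k =
          hcat n V (k+1) * fcg_P s RL RR H G k * transpose_mat (hcat m W (k+1)))
    \<and> (\<forall>k<N. cg_Q A B C1 C2 k =
          hcat n V (k+2) * fcg_Q s RL RR H G k * transpose_mat (hcat m W (k+2)))
    \<and> (\<forall>k\<le>N. frob_norm (cg_R A B C1 C2 k) = frob_norm (fcg_R s RL RR H G k))
    \<and> (\<forall>k\<le>N. frob_norm (cg_R A B C1 C2 k) / frob_norm (cg_R A B C1 C2 0) =
          frob_norm (fcg_R s RL RR H G k) / frob_norm (fcg_R s RL RR H G 0))"
proof -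
  interpret krylov_pair n m s N A B C1 C2 RL RR V W H G
    using A B left_basis right_basis by unfold_locales (auto simp: sym_pos_def_def)
  have X: "X k = VV k * Xf k * transpose_mat (WW k)"
    and Rc: "Rf k \<in> carrier_mat (Suc k * s) (Suc k * s)"
    and R: "R k = VV (Suc k) * Rf k * transpose_mat (WW (Suc k))"
    and Pc: "Pf k \<in> carrier_mat (Suc k * s) (Suc k * s)"
    and P: "P k = VV (Suc k) * Pf k * transpose_mat (WW (Suc k))" if "k \<le> N" for k
    using iterates_lift[OF that] by blast+
  have rho: "\<rho>f k = \<rho> k" if "k \<le> N" for k
    by (rule \<rho>_lift[OF that Rc[OF that] R[OF that]])
  have alpha: "\<alpha>f k = \<alpha> k" if "k < N" for k
    using \<alpha>_lift[OF that rho Pc P] that by simp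
  have beta: "\<beta>f k = \<beta> k" if "k < N" for k
    using that by (simp add: cg_beta.simps fcg_beta.simps rho)
  have Q: "Q k = VV (Suc (Suc k)) * Qf k * transpose_mat (WW (Suc (Suc k)))" if "k < N" for k
    using Q_lift[OF that Pc P] that by simp
  have "fcg_no_breakdown s RL RR H G N"
    unfolding fcg_no_breakdown_def
  proof (intro allI impI)
    fix k assume k: "k < N"
    then have "frob_inner (P k) (Q k) \<noteq> 0" and "\<rho> k \<noteq> 0"
      using cg by (auto simp: cg_no_breakdown_def)
    then show "frob_inner (Pf k) (leading_submatrix ((k+1)*s) ((k+1)*s) (Qf k)) \<noteq> 0 \<and> \<rho>f k \<noteq> 0"
      unfolding P_Q_inner[OF k Pc[OF less_imp_le[OF k]] P[OF less_imp_le[OF k]]]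
      using rho[OF less_imp_le[OF k]] by simp
  qed
  moreover have norm: "frob_norm (R k) = frob_norm (Rf k)" if "k \<le> N" for k
    using rho[OF that] by (simp add: frob_norm_def cg_rho.simps fcg_rho.simps)
  moreover have "X 0 = 0\<^sub>m n m"
    using A_carrier B_carrier by (simp add: cg_X.simps)
  moreover have "k + 1 = Suc k" "k + 2 = Suc (Suc k)" for k :: nat by simp_all
  ultimately show ?thesis
    using X R P Q rho alpha beta by (simp only: ball_simps) (auto simp del: hcat.simps)
qed

end
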